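(* Suppose $u_i(t)$ is a solution, at time $t$ and at the $i$-th spatial grid point, of the Bounded Entropy Method (BEM) described in the context. Assume further that $$\mathcal{M}(h)=O(h^n),\qquad \mathcal{M}(h)\ge 0,$$ $$\mathcal{Z}_+,\mathcal{Z}_-\in C^2(\mathbb{R}^+),\qquad \mathcal{Z}_+'(h)\ge 0,\qquad \mathcal{Z}_-'(h)\le 0,$$ $$G'(h)=(1+\alpha h)\int_A^h\frac{1}{\mathcal{M}(s)}\,ds\quad\text{for some fixed }A>0 .$$ Then, given $T>0$, $u_i(t)$ satisfies the following two properties (sums are over one period of grid indices). (I) (Discrete conservation of mass) $$\sum_i\Big(u_i(T)+\frac{\alpha}{2}u_i(T)^2\Big)\Delta x=\sum_i\Big(u_i(0)+\frac{\alpha}{2}u_i(0)^2\Big)\Delta x .$$ (II) (Discrete entropy estimate) $$\sum_iG(u_i(T))\,\Delta x\le\sum_iG(u_i(0))\,\Delta x+\int_0^T\sum_i\Big(\frac{\mathcal{Z}_-(u_i(t))}{2}\Big)^2\Delta x\,dt .$$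
   Context: Let $L>0$, $\alpha\ge0$, $\mathbb{R}^+=(0,\infty)$, $N$ a positive integer and $\Delta x=L/N$. The mobility $\mathcal{M}:[0,\infty)\to[0,\infty)$ is continuous, $C^4$ on $(0,\infty)$, with $\mathcal{M}(s)>0$ for $s>0$; $\mathcal{M}(h)=O(h^n)$ is meant as $h\to0^+$, for an exponent $n$. The entropy $G$ is a function with the derivative given in the claim. Grid functions $v_i$ are periodic in the index, $v_{i+N}=v_i$. Finite differences: $$v_{i,x}=\frac{v_{i+1}-v_i}{\Delta x},\qquad v_{i,\bar x}=\frac{v_i-v_{i-1}}{\Delta x},\qquad v_{i,\bar xx}=\frac{v_{i+1,\bar x}-v_{i,\bar x}}{\Delta x},$$ and $[w_i]_x=(w_{i+1}-w_i)/\Delta x$ for any grid expression $w_i$. The Bounded Entropy Method (BEM), continuous in time and discrete in space, is the ODE system $$(1+\alpha u_i)\frac{du_i}{dt}+\big[m(u_{i-1},u_i)(1+p_{i,\bar x})\big]_x=0,\qquad p_i=u_{i,\bar xx}-\mathcal{Z}_+(u_i)-\mathcal{Z}_-(u_i),$$ with $u_i(0)=u_0(i\Delta x)$ for a given $L$-periodic initial function $u_0>0$, and $$m(s_1,s_2)=\begin{cases}\mathcal{M}(s_1)&\text{if }s_1=s_2,\\[2pt](s_2-s_1)\Big/\displaystyle\int_{s_1}^{s_2}\frac{1}{\mathcal{M}(s)}\,ds&\text{if }s_1\ne s_2.\end{cases}$$ *)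

theory Defs
  imports "HOL-Analysis.Analysis" "HOL-Library.Landau_Symbols"
begin

text \<open>
  Class \<open>C^k\<close> on an open set of reals. Openness of the set makes the use of the two-sided
  derivative operator legitimate at each of its points.
\<close>
definition C_k_on :: "nat \<Rightarrow> (real \<Rightarrow> real) \<Rightarrow> real set \<Rightarrow> bool" where
  "C_k_on k f S \<longleftrightarrow> open S \<and>
     (\<forall>j<k. \<forall>x\<in>S. (deriv ^^ j) f field_differentiable at x) \<and>
     continuous_on S ((deriv ^^ k) f)"

text \<open>
  Grid functions are functions on all integers; \<open>N\<close>-periodicity is imposed separately.
\<close>
definition grid_periodic :: "nat \<Rightarrow> (int \<Rightarrow> real) \<Rightarrow> bool" where
  "grid_periodic N v \<longleftrightarrow> (\<forall>i. v (i + int N) = v i)"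

definition forward_diff :: "real \<Rightarrow> (int \<Rightarrow> real) \<Rightarrow> int \<Rightarrow> real" where
  "forward_diff dx v i = (v (i + 1) - v i) / dx"

definition backward_diff :: "real \<Rightarrow> (int \<Rightarrow> real) \<Rightarrow> int \<Rightarrow> real" where
  "backward_diff dx v i = (v i - v (i - 1)) / dx"

definition second_diff :: "real \<Rightarrow> (int \<Rightarrow> real) \<Rightarrow> int \<Rightarrow> real" where
  "second_diff dx v i = (backward_diff dx v (i + 1) - backward_diff dx v i) / dx"

text \<open>
  The integral is the oriented interval integral, so it changes sign with its bounds.
\<close>
definition bem_mobility :: "(real \<Rightarrow> real) \<Rightarrow> real \<Rightarrow> real \<Rightarrow> real" where
  "bem_mobility M s1 s2 =
     (if s1 = s2 then M s1 else (s2 - s1) / (LBINT s=s1..s2. 1 / M s))"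

definition bem_pressure ::
  "real \<Rightarrow> (real \<Rightarrow> real) \<Rightarrow> (real \<Rightarrow> real) \<Rightarrow> (int \<Rightarrow> real) \<Rightarrow> int \<Rightarrow> real" where
  "bem_pressure dx Zp Zm v i = second_diff dx v i - Zp (v i) - Zm (v i)"

definition bem_flux ::
  "real \<Rightarrow> (real \<Rightarrow> real) \<Rightarrow> (real \<Rightarrow> real) \<Rightarrow> (real \<Rightarrow> real) \<Rightarrow> (int \<Rightarrow> real) \<Rightarrow> int \<Rightarrow> real" where
  "bem_flux dx M Zp Zm v i =
     bem_mobility M (v (i - 1)) (v i) * (1 + backward_diff dx (bem_pressure dx Zp Zm v) i)"

text \<open>
  A solution on the time interval \<open>[0, T]\<close>; \<open>u i t\<close> is the value at grid point \<open>i\<close> and time \<open>t\<close>.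
  The values are required to be positive because \<open>Zp\<close> and \<open>Zm\<close> stand for functions whose
  domain is \<open>(0, \<infinity>)\<close>: the system is meaningful only for positive states. The time
  derivative is one-sided at the two end points.
\<close>
definition bem_solution ::
  "real \<Rightarrow> nat \<Rightarrow> real \<Rightarrow> (real \<Rightarrow> real) \<Rightarrow> (real \<Rightarrow> real) \<Rightarrow> (real \<Rightarrow> real) \<Rightarrow> (real \<Rightarrow> real) \<Rightarrow>
   real \<Rightarrow> (int \<Rightarrow> real \<Rightarrow> real) \<Rightarrow> bool" where
  "bem_solution L N \<alpha> M Zp Zm u0 T u \<longleftrightarrow>
     (let dx = L / real N in
       (\<forall>i. u i 0 = u0 (real_of_int i * dx)) \<and>
       (\<forall>t\<in>{0..T}.
          grid_periodic N (\<lambda>i. u i t) \<and>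
          (\<forall>i. u i t > 0 \<and>
             (\<exists>d. (u i has_real_derivative d) (at t within {0..T}) \<and>
                (1 + \<alpha> * u i t) * d
                  + forward_diff dx (bem_flux dx M Zp Zm (\<lambda>j. u j t)) i = 0))))"

end

theory Submission
  imports Defs
begin

text \<open>
  Both properties come from testing the scheme with a grid function and summing by parts over
  one period, where periodicity removes all boundary terms.

  Mass: the time derivative of \<open>u + \<alpha> u\<^sup>2 / 2\<close> is \<open>(1 + \<alpha> u) u'\<close>, which by the scheme is minus a
  difference quotient of the flux, so it sums to zero.

  Entropy: let \<open>\<phi>(h)\<close> be the integral of \<open>1 / M\<close> from \<open>A\<close> to \<open>h\<close>. The factor \<open>1 + \<alpha> h\<close> in \<open>G'\<close> is
  the one that multiplies \<open>u'\<close> in the scheme, so, up to the factor \<open>\<Delta>x\<close>, the entropy changes at the rate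
  \<open>- \<Sum> \<phi>(u\<^sub>i) [F\<^sub>i]\<^sub>x = \<Sum> F\<^sub>i \<phi>(u\<^sub>i)\<^sub>x\<close>, the last quotient being a backward one. The averaged mobility
  in \<open>F\<^sub>i\<close> is designed to make \<open>m(a, b) (\<phi>(b) - \<phi>(a)) = b - a\<close> exact
  (\<open>bem_mobility_mult_integral_diff\<close>). The degenerate mobility thereby disappears, and with
  \<open>D\<^sub>i\<close> the second difference of \<open>u\<close> there remains, after one more summation by parts,
  \<open>- \<Sum> D\<^sub>i p\<^sub>i = - \<Sum> D\<^sub>i\<^sup>2 + \<Sum> D\<^sub>i Z\<^sub>+(u\<^sub>i) + \<Sum> D\<^sub>i Z\<^sub>-(u\<^sub>i)\<close>.
  The \<open>Z\<^sub>+\<close> sum is nonpositive because \<open>Z\<^sub>+\<close> is nondecreasing (\<open>sum_mono_mult_second_diff_nonpos\<close>),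
  and completing the square bounds the rest by \<open>\<Sum> (Z\<^sub>-(u\<^sub>i) / 2)\<^sup>2\<close>
  (\<open>bem_entropy_rate_le\<close>). Integrating this differential inequality over \<open>[0, T]\<close> gives the estimate.
\<close>

section \<open>Summation by parts on a periodic grid\<close>

lemma sum_int_telescope:
  fixes f :: "int \<Rightarrow> 'a::ab_group_add"
  shows "(\<Sum>i\<in>{0..<int N}. f (i + 1) - f i) = f (int N) - f 0"
proof (induction N)
  case (Suc N)
  have "{0..<int (Suc N)} = insert (int N) {0..<int N}" by auto
  then show ?case using Suc by (simp add: add.commute)
qed simp

lemma sum_forward_diff_periodic:
  assumes "grid_periodic N v"
  shows "(\<Sum>i\<in>{0..<int N}. forward_diff dx v i) = 0"
proof -
  have "v (int N) = v 0"
    using assms unfolding grid_periodic_def by (metis add_0)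
  then show ?thesis
    unfolding forward_diff_def sum_divide_distrib[symmetric] sum_int_telescope by simp
qed

lemma grid_periodic_shift:
  assumes "grid_periodic N v"
  shows "v (i + int N - 1) = v (i - 1)" "v (i + int N + 1) = v (i + 1)"
proof -
  have *: "i + int N - 1 = (i - 1) + int N" "i + int N + 1 = (i + 1) + int N" by simp_all
  show "v (i + int N - 1) = v (i - 1)" "v (i + int N + 1) = v (i + 1)"
    using assms unfolding * grid_periodic_def by blast+
qed

lemma grid_periodic_comp:
  "grid_periodic N v \<Longrightarrow> grid_periodic N (\<lambda>i. f (v i))"
  by (simp add: grid_periodic_def)

lemma grid_periodic_backward_diff:
  assumes "grid_periodic N v"
  shows "grid_periodic N (backward_diff dx v)"
  using assms grid_periodic_shift[OF assms]
  by (simp add: grid_periodic_def backward_diff_def)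

lemma grid_periodic_second_diff:
  assumes "grid_periodic N v"
  shows "grid_periodic N (second_diff dx v)"
  using grid_periodic_backward_diff[OF assms, of dx]
    grid_periodic_shift[OF grid_periodic_backward_diff[OF assms, of dx]]
  by (simp add: grid_periodic_def second_diff_def)

lemma grid_periodic_bem_pressure:
  assumes "grid_periodic N v"
  shows "grid_periodic N (bem_pressure dx Zp Zm v)"
  using assms grid_periodic_second_diff[OF assms, of dx]
  by (simp add: grid_periodic_def bem_pressure_def)

lemma grid_periodic_bem_flux:
  assumes "grid_periodic N v"
  shows "grid_periodic N (bem_flux dx M Zp Zm v)"
  using assms grid_periodic_shift[OF assms]
    grid_periodic_backward_diff[OF grid_periodic_bem_pressure[OF assms, of dx Zp Zm], of dx]
  by (simp add: grid_periodic_def bem_flux_def)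

text \<open>
  The two sides differ by the telescoping sum of the difference quotients of \<open>v\<^sub>i\<^sub>-\<^sub>1 w\<^sub>i\<close>.
\<close>
lemma sum_by_parts_periodic:
  assumes v: "grid_periodic N v" and w: "grid_periodic N w"
  shows "(\<Sum>i\<in>{0..<int N}. v i * forward_diff dx w i)
           = - (\<Sum>i\<in>{0..<int N}. w i * backward_diff dx v i)"
proof -
  have "grid_periodic N (\<lambda>i. v (i - 1) * w i)"
    using w grid_periodic_shift[OF v] by (simp add: grid_periodic_def)
  then have "(\<Sum>i\<in>{0..<int N}. forward_diff dx (\<lambda>i. v (i - 1) * w i) i) = 0"
    by (rule sum_forward_diff_periodic)
  moreover have "forward_diff dx (\<lambda>i. v (i - 1) * w i) i
      = v i * forward_diff dx w i + w i * backward_diff dx v i" for i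
    by (simp add: forward_diff_def backward_diff_def add_divide_distrib[symmetric] algebra_simps)
  ultimately show ?thesis by (simp add: sum.distrib)
qed

lemma sum_mult_second_diff:
  assumes "grid_periodic N v" and "grid_periodic N w"
  shows "(\<Sum>i\<in>{0..<int N}. w i * second_diff dx v i)
           = - (\<Sum>i\<in>{0..<int N}. backward_diff dx v i * backward_diff dx w i)"
  using sum_by_parts_periodic[OF assms(2) grid_periodic_backward_diff[OF assms(1), of dx], of dx]
  by (simp add: second_diff_def forward_diff_def)

lemma sum_backward_diff_periodic:
  assumes "grid_periodic N v"
  shows "(\<Sum>i\<in>{0..<int N}. backward_diff dx v i) = 0"
  using sum_by_parts_periodic[OF assms, of "\<lambda>_. 1" dx]
  by (simp add: grid_periodic_def forward_diff_def)

text \<open>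
  Discrete counterpart of \<open>\<integral> v'' f(v) = - \<integral> f'(v) v'\<^sup>2 \<le> 0\<close>: increments of \<open>v\<close> and of \<open>f(v)\<close>
  have the same sign.
\<close>
lemma sum_mono_mult_second_diff_nonpos:
  assumes v: "grid_periodic N v" and f: "mono_on S f" and S: "\<And>i. v i \<in> S"
  shows "(\<Sum>i\<in>{0..<int N}. f (v i) * second_diff dx v i) \<le> 0"
proof -
  have "0 \<le> (b - a) * (f b - f a)" if "a \<in> S" "b \<in> S" for a b
    using mono_onD[OF f that] mono_onD[OF f that(2,1)]
    by (cases "a \<le> b") (auto intro: mult_nonneg_nonneg mult_nonpos_nonpos)
  then have "0 \<le> backward_diff dx v i * backward_diff dx (\<lambda>i. f (v i)) i" for i
    using S by (simp add: backward_diff_def)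
  then show ?thesis
    by (simp add: sum_mult_second_diff[OF v grid_periodic_comp[OF v]] sum_nonneg)
qed

section \<open>The averaged mobility\<close>

lemma interval_integral_inverse_mobility:
  fixes M :: "real \<Rightarrow> real" and a b :: real
  assumes M: "continuous_on {0<..} M" "\<forall>h>0. M h > 0" and "0 < a" "0 < b"
  shows "interval_lebesgue_integrable lborel (ereal a) (ereal b) (\<lambda>s. 1 / M s)"
    and "a < b \<Longrightarrow> 0 < (LBINT s=a..b. 1 / M s)"
proof -
  have cont: "continuous_on {0<..} (\<lambda>s. 1 / M s)"
    using M by (intro continuous_intros) force+
  then have isCont: "isCont (\<lambda>s. 1 / M s) x" if "0 < x" for x
    using that by (simp add: continuous_on_eq_continuous_at)
  show "interval_lebesgue_integrable lborel (ereal a) (ereal b) (\<lambda>s. 1 / M s)"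
    using assms(3,4) by (intro interval_integrable_isCont isCont) auto
  show "0 < (LBINT s=a..b. 1 / M s)" if "a < b"
  proof -
    have "continuous_on {a..b} (\<lambda>s. 1 / M s)"
      by (rule continuous_on_subset[OF cont]) (use assms(3) in auto)
    then obtain c where c: "c \<in> {a..b}" "\<And>s. s \<in> {a..b} \<Longrightarrow> 1 / M c \<le> 1 / M s"
      using continuous_attains_inf[of "{a..b}" "\<lambda>s. 1 / M s"] \<open>a < b\<close> by auto
    have "0 < (b - a) * (1 / M c)"
      using \<open>a < b\<close> M(2) c(1) assms(3) by simp
    also have "\<dots> = integral {a..b} (\<lambda>_. 1 / M c)" using \<open>a < b\<close> by simp
    also have "\<dots> \<le> integral {a..b} (\<lambda>s. 1 / M s)"
      using c(2) \<open>continuous_on {a..b} (\<lambda>s. 1 / M s)\<close>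
      by (intro integral_le integrable_continuous_real) auto
    also have "\<dots> = (LBINT s=a..b. 1 / M s)"
      using \<open>a < b\<close> borel_integrable_atLeastAtMost'[OF \<open>continuous_on {a..b} (\<lambda>s. 1 / M s)\<close>]
      by (intro interval_integral_eq_integral[symmetric]) auto
    finally show ?thesis .
  qed
qed

text \<open>
  This exact discrete chain rule is the reason for averaging \<open>M\<close> harmonically. The integral must
  be nonzero for \<open>a \<noteq> b\<close>, which is where positivity of \<open>M\<close> enters.
\<close>
lemma bem_mobility_mult_integral_diff:
  fixes A a b :: real
  assumes M: "continuous_on {0<..} M" "\<forall>h>0. M h > 0" and pos: "0 < A" "0 < a" "0 < b"
  shows "bem_mobility M a b * ((LBINT s=A..b. 1 / M s) - (LBINT s=A..a. 1 / M s)) = b - a"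
proof (cases "a = b")
  case False
  note I = interval_integral_inverse_mobility[OF M]
  have "interval_lebesgue_integrable lborel (ereal (min A (min a b))) (ereal (max A (max a b)))
          (\<lambda>s. 1 / M s)"
    using pos by (intro I(1)) auto
  then have split: "(LBINT s=A..a. 1 / M s) + (LBINT s=a..b. 1 / M s) = (LBINT s=A..b. 1 / M s)"
    by (intro interval_integral_sum) (simp flip: ereal_min ereal_max)
  have "(LBINT s=a..b. 1 / M s) \<noteq> 0"
    using False I(2)[OF pos(2,3)] I(2)[OF pos(3,2)]
      interval_integral_endpoints_reverse[of a b "\<lambda>s. 1 / M s"]
    by (cases "a < b") auto
  then show ?thesis
    using False by (simp add: bem_mobility_def flip: split)
qed simp

section \<open>The entropy production rate\<close>

text \<open>
  The left-hand side is the rate of change of the entropy along the scheme, divided by the mesh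
  width. The drift term \<open>1\<close> in the flux contributes the sum of the difference quotients of \<open>v\<close> over
  a period, which is zero.
\<close>
lemma bem_entropy_rate_le:
  fixes A :: real
  assumes M: "continuous_on {0<..} M" "\<forall>h>0. M h > 0" and "A > 0"
    and Zp: "mono_on {0<..} Zp"
    and v: "grid_periodic N v" "\<And>i. v i > 0"
  shows "- (\<Sum>i\<in>{0..<int N}.
              (LBINT s=A..v i. 1 / M s) * forward_diff dx (bem_flux dx M Zp Zm v) i)
           \<le> (\<Sum>i\<in>{0..<int N}. (Zm (v i) / 2)\<^sup>2)"
proof -
  define \<phi> where "\<phi> = (\<lambda>h::real. LBINT s=A..h. 1 / M s)"
  define p where "p = bem_pressure dx Zp Zm v"
  define D where "D = second_diff dx v"
  have flux: "bem_flux dx M Zp Zm v i * backward_diff dx (\<lambda>i. \<phi> (v i)) i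
      = backward_diff dx v i + backward_diff dx v i * backward_diff dx p i" for i
  proof -
    have "bem_mobility M (v (i - 1)) (v i) * backward_diff dx (\<lambda>i. \<phi> (v i)) i
        = backward_diff dx v i"
      using bem_mobility_mult_integral_diff[OF M \<open>A > 0\<close> v(2)[of "i - 1"] v(2)[of i]]
      by (simp add: backward_diff_def \<phi>_def)
    then show ?thesis by (simp add: bem_flux_def p_def algebra_simps)
  qed
  have "- (\<Sum>i\<in>{0..<int N}. \<phi> (v i) * forward_diff dx (bem_flux dx M Zp Zm v) i)
      = (\<Sum>i\<in>{0..<int N}. backward_diff dx v i)
        + (\<Sum>i\<in>{0..<int N}. backward_diff dx v i * backward_diff dx p i)"
    by (simp add: sum_by_parts_periodic[OF grid_periodic_comp[OF v(1)]
          grid_periodic_bem_flux[OF v(1)]] flux sum.distrib)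
  also have "\<dots> = - (\<Sum>i\<in>{0..<int N}. p i * D i)"
    unfolding D_def p_def
    by (simp add: sum_mult_second_diff[OF v(1) grid_periodic_bem_pressure[OF v(1)]]
        sum_backward_diff_periodic[OF v(1)])
  also have "\<dots> = (\<Sum>i\<in>{0..<int N}. Zp (v i) * D i)
      + (\<Sum>i\<in>{0..<int N}. Zm (v i) * D i - (D i)\<^sup>2)"
    by (simp add: p_def bem_pressure_def D_def power2_eq_square algebra_simps
        sum.distrib sum_subtractf)
  also have "\<dots> \<le> 0 + (\<Sum>i\<in>{0..<int N}. (Zm (v i) / 2)\<^sup>2)"
  proof (intro add_mono sum_mono)
    show "(\<Sum>i\<in>{0..<int N}. Zp (v i) * D i) \<le> 0"
      unfolding D_def using v by (intro sum_mono_mult_second_diff_nonpos[OF v(1) Zp]) auto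
    show "Zm (v i) * D i - (D i)\<^sup>2 \<le> (Zm (v i) / 2)\<^sup>2" for i
      using zero_le_power2[of "Zm (v i) / 2 - D i"] by (simp add: power2_eq_square algebra_simps)
  qed
  finally show ?thesis by (simp add: \<phi>_def)
qed

section \<open>Integration in time\<close>

lemma C_k_on_has_real_derivative:
  assumes "C_k_on k f S" "0 < k" "x \<in> S"
  shows "(f has_real_derivative deriv f x) (at x)"
proof -
  have "(deriv ^^ 0) f field_differentiable at x"
    using assms unfolding C_k_on_def by blast
  then show ?thesis by (simp add: DERIV_deriv_iff_field_differentiable)
qed

lemma mono_on_pos_reals_of_deriv_nonneg:
  fixes f :: "real \<Rightarrow> real"
  assumes "\<And>x. x > 0 \<Longrightarrow> (f has_real_derivative f' x) (at x)" "\<And>x. x > 0 \<Longrightarrow> f' x \<ge> 0"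
  shows "mono_on {0<..} f"
proof (rule mono_onI)
  fix r s :: real assume rs: "r \<in> {0<..}" "r \<le> s"
  have "\<exists>y. (f has_real_derivative y) (at x) \<and> 0 \<le> y" if "r \<le> x" for x
    using assms[of x] rs(1) that by auto
  then show "f r \<le> f s"
    using DERIV_nonneg_imp_nondecreasing[OF rs(2)] by blast
qed

lemma bem_solutionD:
  assumes "bem_solution L N \<alpha> M Zp Zm u0 T u" "\<alpha> \<ge> 0" "t \<in> {0..T}"
  shows "grid_periodic N (\<lambda>i. u i t)" and "u i t > 0"
    and "(u i has_real_derivative
            - forward_diff (L / real N) (bem_flux (L / real N) M Zp Zm (\<lambda>j. u j t)) i
              / (1 + \<alpha> * u i t)) (at t within {0..T})"
proof -
  show "grid_periodic N (\<lambda>i. u i t)" and pos: "u i t > 0"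
    using assms by (auto simp: bem_solution_def Let_def)
  obtain d where d: "(u i has_real_derivative d) (at t within {0..T})"
    "(1 + \<alpha> * u i t) * d
       + forward_diff (L / real N) (bem_flux (L / real N) M Zp Zm (\<lambda>j. u j t)) i = 0"
    using assms unfolding bem_solution_def Let_def by blast
  have "1 + \<alpha> * u i t > 0"
    using pos \<open>\<alpha> \<ge> 0\<close> by (simp add: add_pos_nonneg)
  then have "d = - forward_diff (L / real N) (bem_flux (L / real N) M Zp Zm (\<lambda>j. u j t)) i
      / (1 + \<alpha> * u i t)"
    using d(2) by (simp add: field_simps eq_neg_iff_add_eq_0)
  then show "(u i has_real_derivative
            - forward_diff (L / real N) (bem_flux (L / real N) M Zp Zm (\<lambda>j. u j t)) i
              / (1 + \<alpha> * u i t)) (at t within {0..T})"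
    using d(1) by simp
qed

text \<open>
  For both the mass density \<open>H(u) = u + \<alpha> u\<^sup>2 / 2\<close> and the entropy \<open>G\<close>, the derivative has the
  factor \<open>1 + \<alpha> u\<close> that cancels the coefficient of \<open>u'\<close> in the scheme.
\<close>
lemma bem_solution_sum_has_derivative:
  assumes sol: "bem_solution L N \<alpha> M Zp Zm u0 T u" "\<alpha> \<ge> 0" "t \<in> {0..T}"
    and H: "\<And>h. h > 0 \<Longrightarrow> (H has_real_derivative (1 + \<alpha> * h) * \<psi> h) (at h)"
  shows "((\<lambda>t. \<Sum>i\<in>{0..<int N}. H (u i t) * (L / real N)) has_real_derivative
           - (\<Sum>i\<in>{0..<int N}. \<psi> (u i t)
               * forward_diff (L / real N) (bem_flux (L / real N) M Zp Zm (\<lambda>j. u j t)) i)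
             * (L / real N)) (at t within {0..T})"
proof -
  let ?F = "\<lambda>i. forward_diff (L / real N) (bem_flux (L / real N) M Zp Zm (\<lambda>j. u j t)) i"
  have "((\<lambda>t. H (u i t) * (L / real N)) has_real_derivative
      - (\<psi> (u i t) * ?F i) * (L / real N)) (at t within {0..T})" for i
  proof -
    have "1 + \<alpha> * u i t > 0"
      using bem_solutionD(2)[OF sol] \<open>\<alpha> \<ge> 0\<close> by (simp add: add_pos_nonneg less_imp_le)
    then have "(1 + \<alpha> * u i t) * \<psi> (u i t) * (- ?F i / (1 + \<alpha> * u i t)) = - (\<psi> (u i t) * ?F i)"
      by simp
    then have "((\<lambda>t. H (u i t)) has_real_derivative - (\<psi> (u i t) * ?F i)) (at t within {0..T})"
      using DERIV_chain2[OF H[OF bem_solutionD(2)[OF sol]] bem_solutionD(3)[OF sol], of i] by metis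
    then show ?thesis by (rule DERIV_cmult_right)
  qed
  then have "((\<lambda>t. \<Sum>i\<in>{0..<int N}. H (u i t) * (L / real N)) has_real_derivative
      (\<Sum>i\<in>{0..<int N}. - (\<psi> (u i t) * ?F i) * (L / real N))) (at t within {0..T})"
    by (rule DERIV_sum)
  then show ?thesis by (simp add: sum_distrib_right sum_negf sum_divide_distrib)
qed

text \<open>
  The Henstock--Kurzweil integral recovers \<open>f\<close> from any derivative, so the bound can be integrated
  without first establishing regularity of \<open>f'\<close>.
\<close>
lemma diff_le_interval_integral_of_derivative_le:
  fixes f f' g :: "real \<Rightarrow> real"
  assumes "a \<le> b"
    and "\<And>t. t \<in> {a..b} \<Longrightarrow> (f has_real_derivative f' t) (at t within {a..b})"
    and "continuous_on {a..b} g"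
    and "\<And>t. t \<in> {a..b} \<Longrightarrow> f' t \<le> g t"
  shows "f b - f a \<le> (LBINT t=a..b. g t)"
proof -
  have "(f' has_integral f b - f a) {a..b}"
    using assms(1,2)
    by (intro fundamental_theorem_of_calculus) (auto simp: has_real_derivative_iff_has_vector_derivative)
  moreover have "(g has_integral integral {a..b} g) {a..b}"
    using assms(3) by (intro integrable_integral integrable_continuous_real)
  ultimately have "f b - f a \<le> integral {a..b} g"
    by (rule has_integral_le) (use assms(4) in auto)
  also have "\<dots> = (LBINT t=a..b. g t)"
    using assms(1,3) by (intro interval_integral_eq_integral[symmetric] borel_integrable_atLeastAtMost')
  finally show ?thesis .
qed

section \<open>Mass conservation and entropy estimate\<close>

theorem proposition4p1:
  fixes L \<alpha> A T n :: real and N :: nat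
    and M Zp Zm G u0 :: "real \<Rightarrow> real"
    and u :: "int \<Rightarrow> real \<Rightarrow> real"
  assumes "L > 0" and "\<alpha> \<ge> 0" and "N > 0"
    and "continuous_on {0..} M" and "C_k_on 4 M {0<..}"
    and "\<And>h. h \<ge> 0 \<Longrightarrow> M h \<ge> 0" and "\<And>h. h > 0 \<Longrightarrow> M h > 0"
    and "M \<in> O[at_right 0](\<lambda>h. h powr n)"
    and "C_k_on 2 Zp {0<..}" and "C_k_on 2 Zm {0<..}"
    and "\<And>h. h > 0 \<Longrightarrow> deriv Zp h \<ge> 0" and "\<And>h. h > 0 \<Longrightarrow> deriv Zm h \<le> 0"
    and "A > 0"
    and "\<And>h. h > 0 \<Longrightarrow>
           (G has_real_derivative (1 + \<alpha> * h) * (LBINT s=A..h. 1 / M s)) (at h)"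
    and "\<And>x. u0 (x + L) = u0 x" and "\<And>x. u0 x > 0"
    and "T > 0"
    and "bem_solution L N \<alpha> M Zp Zm u0 T u"
  shows "(\<Sum>i\<in>{0..<int N}. (u i T + \<alpha> / 2 * (u i T)\<^sup>2) * (L / real N))
           = (\<Sum>i\<in>{0..<int N}. (u i 0 + \<alpha> / 2 * (u i 0)\<^sup>2) * (L / real N))
       \<and> (\<Sum>i\<in>{0..<int N}. G (u i T) * (L / real N))
           \<le> (\<Sum>i\<in>{0..<int N}. G (u i 0) * (L / real N))
             + (LBINT t=0..T. (\<Sum>i\<in>{0..<int N}. (Zm (u i t) / 2)\<^sup>2 * (L / real N)))"
proof -
  define dx where "dx = L / real N"
  note sol = \<open>bem_solution L N \<alpha> M Zp Zm u0 T u\<close> \<open>\<alpha> \<ge> 0\<close>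
  have M: "continuous_on {0<..} M" "\<forall>h>0. M h > 0"
    using continuous_on_subset[OF \<open>continuous_on {0..} M\<close>, of "{0<..}"] assms(7) by (auto simp: subset_iff)
  have Zp: "mono_on {0<..} Zp"
    using C_k_on_has_real_derivative[OF \<open>C_k_on 2 Zp {0<..}\<close>] assms(11)
    by (intro mono_on_pos_reals_of_deriv_nonneg[of Zp "deriv Zp"]) auto
  have Zm: "continuous_on {0<..} Zm"
    using C_k_on_has_real_derivative[OF \<open>C_k_on 2 Zm {0<..}\<close>]
    by (intro continuous_at_imp_continuous_on) (auto intro: DERIV_isCont)
  have u_cont: "continuous_on {0..T} (u i)" for i
    by (rule DERIV_continuous_on[OF bem_solutionD(3)[OF sol]])
  let ?mass = "\<lambda>t. \<Sum>i\<in>{0..<int N}. (u i t + \<alpha> / 2 * (u i t)\<^sup>2) * dx"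
  have "(?mass has_real_derivative 0) (at t within {0..T})" if "t \<in> {0..T}" for t
  proof -
    \<comment> \<open>The mass is tested with the constant grid function \<open>1\<close>, which leaves the bare sum of flux differences.\<close>
    have "((\<lambda>h. h + \<alpha> / 2 * h\<^sup>2) has_real_derivative (1 + \<alpha> * h) * 1) (at h)" for h
      by (auto intro!: derivative_eq_intros)
    from bem_solution_sum_has_derivative[OF sol that this] show ?thesis
      using sum_forward_diff_periodic[OF grid_periodic_bem_flux[OF bem_solutionD(1)[OF sol that]]]
      by (simp add: dx_def)
  qed
  then have mass: "?mass T = ?mass 0"
    using has_field_derivative_zero_constant[of "{0..T}" ?mass] \<open>T > 0\<close> by fastforce
  let ?entropy = "\<lambda>t. \<Sum>i\<in>{0..<int N}. G (u i t) * dx"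
  have "?entropy T - ?entropy 0
      \<le> (LBINT t=0..T. (\<Sum>i\<in>{0..<int N}. (Zm (u i t) / 2)\<^sup>2 * dx))"
    unfolding zero_ereal_def
  proof (rule diff_le_interval_integral_of_derivative_le)
    fix t assume t: "t \<in> {0..T}"
    show "(?entropy has_real_derivative
        - (\<Sum>i\<in>{0..<int N}. (LBINT s=A..u i t. 1 / M s)
             * forward_diff dx (bem_flux dx M Zp Zm (\<lambda>j. u j t)) i) * dx) (at t within {0..T})"
      unfolding dx_def by (rule bem_solution_sum_has_derivative[OF sol t assms(14)])
    show "- (\<Sum>i\<in>{0..<int N}. (LBINT s=A..u i t. 1 / M s)
             * forward_diff dx (bem_flux dx M Zp Zm (\<lambda>j. u j t)) i) * dx
        \<le> (\<Sum>i\<in>{0..<int N}. (Zm (u i t) / 2)\<^sup>2 * dx)"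
      unfolding sum_distrib_right[symmetric]
    proof (rule mult_right_mono)
      show "0 \<le> dx" using \<open>L > 0\<close> by (simp add: dx_def)
    qed (rule bem_entropy_rate_le[OF M \<open>A > 0\<close> Zp bem_solutionD(1,2)[OF sol t]])
  next
    show "continuous_on {0..T} (\<lambda>t. \<Sum>i\<in>{0..<int N}. (Zm (u i t) / 2)\<^sup>2 * dx)"
      by (intro continuous_intros continuous_on_compose2[OF Zm u_cont])
        (auto intro: bem_solutionD(2)[OF sol])
  qed (use \<open>T > 0\<close> in simp)
  with mass show ?thesis
    unfolding dx_def by simp
qed

end
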